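(* Let $q\in\mathbb{C}$ with $|q|<1$, let $r\ge1$, let $a_1,\dots,a_r,b_1,\dots,b_r$ be positive integers, let $\chi$ be a Dirichlet character with odd conductor $f$, and let $k$ be a positive integer. Then $$L_r(-k,\chi\mid a_1,\dots,a_r;b_1,\dots,b_r)=E_{k,\chi,q}(a_1,\dots,a_r;b_1,\dots,b_r).$$
   Context: The multivariate Dirichlet $L$-function is, for $s\in\mathbb{C}$, $$L_r(s,\chi\mid a_1,\dots,a_r;b_1,\dots,b_r)=2^r\sum_{n_1,\dots,n_r=1}^{\infty}\frac{(-1)^{n_1+\cdots+n_r}q^{b_1n_1+\cdots+b_rn_r}\chi(n_1)\cdots\chi(n_r)}{(a_1n_1+\cdots+a_rn_r)^s}.$$ The multivariate generalized $q$-Euler numbers attached to $\chi$, $E_{n,\chi,q}(a_1,\dots,a_r;b_1,\dots,b_r)$, are defined by the generating function (expansion near $t=0$) $$\sum_{m_1,\dots,m_r=0}^{f-1}\frac{2^r(-1)^{m_1+\cdots+m_r}q^{b_1m_1+\cdots+b_rm_r}e^{(a_1m_1+\cdots+a_rm_r)t}\chi(m_1)\cdots\chi(m_r)}{(q^{fb_1}e^{fa_1t}+1)\cdots(q^{fb_r}e^{fa_rt}+1)}=\sum_{n=0}^{\infty}E_{n,\chi,q}(a_1,\dots,a_r;b_1,\dots,b_r)\frac{t^n}{n!}.$$ Here $\chi$ is regarded as a function on $\mathbb{Z}$ with $\chi(m)=0$ when $\gcd(m,f)>1$.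
   Formalization: The trivial character (f = 1) is excluded when r ≥ 2, since the claim fails there: for r = 2, f = 1, a = b = (1,1), k = 1 one gets E_1 = -8q/(1+q)^3 but L_2(-1) = 8q^2/(1+q)^3, because χ(0) = 1. *)

theory Defs
  imports
    "HOL-Complex_Analysis.Complex_Analysis"
    "HOL-Library.FuncSet"
    "HOL-Number_Theory.Cong"
begin

definition dirichlet_character :: "nat \<Rightarrow> (int \<Rightarrow> complex) \<Rightarrow> bool" where
  "dirichlet_character n chi \<longleftrightarrow>
     n > 0 \<and>
     (\<forall>m. chi (m + int n) = chi m) \<and>
     (\<forall>m l. chi (m * l) = chi m * chi l) \<and>
     (\<forall>m. chi m = 0 \<longleftrightarrow> gcd m (int n) > 1)"

text \<open>
  The conductor of a character modulo \<open>n\<close> is the least divisor \<open>d\<close> of \<open>n\<close> such that the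
  character factors through the units modulo \<open>d\<close>. A character modulo \<open>f\<close> is primitive iff
  its conductor is \<open>f\<close>.
\<close>
definition conductor :: "nat \<Rightarrow> (int \<Rightarrow> complex) \<Rightarrow> nat" where
  "conductor n chi =
     (LEAST d. d > 0 \<and> d dvd n \<and>
        (\<forall>m. coprime m (int n) \<and> [m = 1] (mod int d) \<longrightarrow> chi m = 1))"

text \<open>
  Tuples indexed by \<open>1, \<dots>, r\<close> are functions on \<open>{1..r}\<close>; the summation indices range over
  extensional functions so that each tuple is counted once.
\<close>
definition multi_L ::
  "nat \<Rightarrow> complex \<Rightarrow> complex \<Rightarrow> (int \<Rightarrow> complex) \<Rightarrow> (nat \<Rightarrow> nat) \<Rightarrow> (nat \<Rightarrow> nat) \<Rightarrow> complex" where
  "multi_L r q s chi a b =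
     2 ^ r * (\<Sum>\<^sub>\<infinity>n\<in>{1..r} \<rightarrow>\<^sub>E {1..}.
       (-1) ^ (\<Sum>i=1..r. n i) * q ^ (\<Sum>i=1..r. b i * n i) * (\<Prod>i=1..r. chi (int (n i)))
         / of_nat (\<Sum>i=1..r. a i * n i) powr s)"

definition multi_euler_gf ::
  "nat \<Rightarrow> complex \<Rightarrow> nat \<Rightarrow> (int \<Rightarrow> complex) \<Rightarrow> (nat \<Rightarrow> nat) \<Rightarrow> (nat \<Rightarrow> nat) \<Rightarrow> complex \<Rightarrow> complex" where
  "multi_euler_gf r q f chi a b t =
     (\<Sum>m\<in>{1..r} \<rightarrow>\<^sub>E {0..<f}.
       2 ^ r * (-1) ^ (\<Sum>i=1..r. m i) * q ^ (\<Sum>i=1..r. b i * m i)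
         * exp (of_nat (\<Sum>i=1..r. a i * m i) * t) * (\<Prod>i=1..r. chi (int (m i)))
         / (\<Prod>i=1..r. q ^ (f * b i) * exp (of_nat (f * a i) * t) + 1))"

definition multi_euler ::
  "nat \<Rightarrow> complex \<Rightarrow> nat \<Rightarrow> (int \<Rightarrow> complex) \<Rightarrow> (nat \<Rightarrow> nat) \<Rightarrow> (nat \<Rightarrow> nat) \<Rightarrow> nat \<Rightarrow> complex" where
  "multi_euler r q f chi a b n = fact n * fps_nth (fps_expansion (multi_euler_gf r q f chi a b) 0) n"

lemma multi_euler_gf_analytic:
  assumes "norm q < 1" "f > 0" "\<forall>i\<in>{1..r}. b i > 0"
  shows "multi_euler_gf r q f chi a b analytic_on {0}"
proof -
  have nz: "q ^ (f * b i) + 1 \<noteq> 0" if "i \<in> {1..r}" for i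
  proof
    assume "q ^ (f * b i) + 1 = 0"
    hence "q ^ (f * b i) = -1" by (simp add: eq_neg_iff_add_eq_0)
    hence "norm q ^ (f * b i) = 1" by (metis norm_minus_cancel norm_one norm_power)
    moreover have "norm q ^ (f * b i) < 1"
      using assms that by (intro power_less_one_iff[THEN iffD2]) auto
    ultimately show False by simp
  qed
  show ?thesis
    unfolding multi_euler_gf_def
    by (intro analytic_intros) (use nz in auto)
qed

text \<open>The numbers are the ones determined by the generating function near \<open>t = 0\<close>.\<close>
lemma multi_euler_sums:
  assumes "norm q < 1" "f > 0" "\<forall>i\<in>{1..r}. b i > 0"
  shows "\<forall>\<^sub>F t in nhds 0.
           (\<lambda>n. multi_euler r q f chi a b n * t ^ n / fact n) sums multi_euler_gf r q f chi a b t"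
proof -
  let ?F = "fps_expansion (multi_euler_gf r q f chi a b) 0"
  have F: "multi_euler_gf r q f chi a b has_fps_expansion ?F"
    by (rule analytic_at_imp_has_fps_expansion_0[OF multi_euler_gf_analytic[OF assms]])
  hence R: "fps_conv_radius ?F > 0"
    by (simp add: has_fps_expansion_def)
  have "\<forall>\<^sub>F t in nhds 0. t \<in> eball (0::complex) (fps_conv_radius ?F)"
    using R by (intro eventually_nhds_in_open) (auto simp: zero_ereal_def)
  moreover have "\<forall>\<^sub>F t in nhds 0. eval_fps ?F t = multi_euler_gf r q f chi a b t"
    using F by (simp add: has_fps_expansion_def)
  ultimately show ?thesis
  proof eventually_elim
    case (elim t)
    hence "(\<lambda>n. fps_nth ?F n * t ^ n) sums eval_fps ?F t"
      by (intro sums_eval_fps) auto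
    thus ?case using elim by (simp add: multi_euler_def)
  qed
qed

end

theory Submission
  imports Defs
begin

text \<open>
  Put \<open>x = q\<^sup>b e\<^sup>a\<^sup>t\<close>. For \<open>norm x < 1\<close> and odd \<open>f\<close>, the \<open>f\<close>-periodicity of \<open>chi\<close> shows that shifting
  the series \<open>\<Sum>n. chi n (- x)\<^sup>n\<close> by \<open>f\<close> multiplies it by \<open>- x\<^sup>f\<close>, so it equals
  \<open>(\<Sum>m<f. chi m (- x)\<^sup>m) / (x\<^sup>f + 1)\<close>. The generating function is a product of \<open>r\<close> such quotients,
  hence for small \<open>t\<close> an absolutely convergent multiple sum of exponentials. Expanding each
  exponential and exchanging the summations gives its Taylor coefficients, which are the
  multiple \<open>L\<close>-values except that the indices start at \<open>0\<close>.
\<close>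

section \<open>Power series with periodic coefficients\<close>

text \<open>Every value is attained on one period \<open>{0..<int f}\<close>, so the sum of the
  norms over that period serves as the bound.\<close>

lemma periodic_imp_bounded:
  fixes g :: "int \<Rightarrow> 'a :: real_normed_vector"
  assumes "f > 0" and per: "\<And>m. g (m + int f) = g m"
  obtains M where "\<And>m. norm (g m) \<le> M"
proof -
  have shift: "g (m + int f * int l) = g m" for m l
  proof (induction l)
    case (Suc l)
    then show ?case
      using per[of "m + int f * int l"] by (simp add: algebra_simps)
  qed simp
  \<comment> \<open>\<open>shift\<close> only moves upwards, so for \<open>m < 0\<close> it starts
    at \<open>m\<close> itself and climbs \<open>- (m div int f)\<close> periods to the
    residue.\<close>
  have "g m = g (m mod int f)" for m
  proof (cases "m \<ge> 0")
    case True
    then have "int (nat (m div int f)) = m div int f"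
      using \<open>f > 0\<close> by (simp add: pos_imp_zdiv_nonneg_iff)
    then show ?thesis
      using shift[of "m mod int f" "nat (m div int f)"] by simp
  next
    case False
    then have "int (nat (- (m div int f))) = - (m div int f)"
      using \<open>f > 0\<close> by (simp add: pos_imp_zdiv_neg_iff less_imp_le)
    then show ?thesis
      using shift[of m "nat (- (m div int f))"]
      by (simp add: minus_mult_div_eq_mod flip: minus_mult_right)
  qed
  moreover have "m mod int f \<in> {0..<int f}" for m
    using \<open>f > 0\<close> by simp
  ultimately have "norm (g m) \<le> (\<Sum>l\<in>{0..<int f}. norm (g l))" for m
    by (metis finite_atLeastLessThan_int member_le_sum norm_ge_zero)
  then show ?thesis by (rule that)
qed

lemma summable_power_mult_bounded:
  fixes g :: "nat \<Rightarrow> 'a :: real_normed_vector" and y :: real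
  assumes "0 \<le> y" "y < 1" and "\<And>n. norm (g n) \<le> M"
  shows "summable (\<lambda>n. norm (g n) * y ^ n)"
proof (rule summable_comparison_test')
  show "summable (\<lambda>n. M * y ^ n)"
    using assms by (intro summable_mult summable_geometric) auto
qed (use assms in \<open>auto simp: abs_mult intro!: mult_right_mono\<close>)

lemma has_sum_alternating_periodic:
  fixes chi :: "int \<Rightarrow> complex" and x :: complex
  assumes "odd f" and per: "\<And>m. chi (m + int f) = chi m" and "norm x < 1"
  shows "((\<lambda>n. chi (int n) * (- x) ^ n) has_sum
           ((\<Sum>m<f. chi (int m) * (- x) ^ m) / (x ^ f + 1))) UNIV"
proof -
  define u where "u = (\<lambda>n. chi (int n) * (- x) ^ n)"
  have "f > 0" using \<open>odd f\<close> by (auto intro: Nat.gr0I)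
  then obtain M where "\<And>m. norm (chi m) \<le> M"
    using periodic_imp_bounded per by metis
  then have sn: "summable (\<lambda>n. norm (u n))"
    using summable_power_mult_bounded[of "norm x" "\<lambda>n. chi (int n)" M] \<open>norm x < 1\<close>
    by (simp add: u_def norm_mult norm_power)
  then have su: "summable u" by (rule summable_norm_cancel)
  \<comment> \<open>Oddness of \<open>f\<close> enters here, through
    \<open>(- x) ^ f = - (x ^ f)\<close>; it produces the \<open>+ 1\<close> in the
    denominator.\<close>
  have ushift: "u (n + f) = - (x ^ f) * u n" for n
    using \<open>odd f\<close> per[of "int n"] by (simp add: u_def power_add)
  have "suminf u = (\<Sum>n. u (n + f)) + sum u {..<f}"
    by (rule suminf_split_initial_segment[OF su])
  also have "(\<Sum>n. u (n + f)) = - (x ^ f) * suminf u"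
    unfolding ushift by (rule suminf_mult[OF su])
  finally have "suminf u * (x ^ f + 1) = sum u {..<f}"
    by (simp add: algebra_simps)
  moreover have "x ^ f + 1 \<noteq> 0"
  proof
    assume "x ^ f + 1 = 0"
    then have "norm x ^ f = 1"
      by (metis add_eq_0_iff2 norm_minus_cancel norm_one norm_power)
    then show False
      using \<open>norm x < 1\<close> \<open>f > 0\<close> by (metis norm_ge_zero less_irrefl power_less_one_iff)
  qed
  ultimately have "suminf u = sum u {..<f} / (x ^ f + 1)"
    by (simp add: field_simps)
  then show ?thesis
    using norm_summable_imp_has_sum[OF sn summable_sums[OF su]] by (simp add: u_def)
qed

section \<open>Interchange of summations and products of series\<close>

text \<open>Fubini for the double family \<open>h n j\<close>: summing over \<open>j\<close> first
  gives \<open>S\<close>, summing over \<open>n\<close> first gives a power series in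
  \<open>t\<close>. Assumption \<open>abs\<close> is the absolute convergence that permits the
  exchange.\<close>

lemma has_sum_exp_series:
  fixes c w :: "'a \<Rightarrow> complex" and t S :: complex
  assumes abs: "(\<lambda>n. norm (c n) * exp (norm (w n * t))) summable_on A"
    and S: "((\<lambda>n. c n * exp (w n * t)) has_sum S) A"
  shows "((\<lambda>j. infsum (\<lambda>n. c n * w n ^ j) A / fact j * t ^ j) has_sum S) UNIV"
proof -
  define h where "h = (\<lambda>n j. c n * ((w n * t) ^ j / fact j))"
  have real_exp: "((\<lambda>j. norm (h n j)) has_sum norm (c n) * exp (norm (w n * t))) UNIV" for n
  proof -
    have "(\<lambda>j. norm (c n) * (norm (w n * t) ^ j / fact j)) sums
            (norm (c n) * exp (norm (w n * t)))"
      using exp_converges[of "norm (w n * t)"]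
      by (intro sums_mult) (simp add: divide_inverse_commute)
    moreover have "norm (h n j) = norm (c n) * (norm (w n * t) ^ j / fact j)" for j
      by (simp add: h_def norm_mult norm_divide norm_power)
    ultimately have "(\<lambda>j. norm (h n j)) sums (norm (c n) * exp (norm (w n * t)))"
      by simp
    then show ?thesis
      by (intro norm_summable_imp_has_sum) (auto simp: sums_iff)
  qed
  have complex_exp: "(h n has_sum c n * exp (w n * t)) UNIV" for n
  proof (rule norm_summable_imp_has_sum)
    show "summable (\<lambda>j. norm (h n j))"
      using has_sum_imp_sums[OF real_exp] by (auto simp: sums_iff)
    show "h n sums (c n * exp (w n * t))"
      unfolding h_def using exp_converges[of "w n * t"]
      by (intro sums_mult) (simp add: scaleR_conv_of_real divide_inverse_commute)
  qed
  \<comment> \<open>The terms are nonnegative and their inner sums over \<open>j\<close> are the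
    family in \<open>abs\<close>, so iterated summability gives joint summability.\<close>
  have "(\<lambda>(n, j). norm (h n j)) summable_on A \<times> UNIV"
    by (rule summable_on_SigmaI[OF _ abs]) (use real_exp in auto)
  then have hs: "(\<lambda>(n, j). h n j) summable_on A \<times> UNIV"
    by (rule abs_summable_summable[OF summable_on_cong[THEN iffD1, rotated]]) auto
  have "((\<lambda>(n, j). h n j) has_sum S) (A \<times> UNIV)"
    by (rule has_sum_SigmaI[OF _ S hs]) (use complex_exp in auto)
  then have swapped: "((\<lambda>(j, n). h n j) has_sum S) (UNIV \<times> A)"
    by (subst (asm) has_sum_swap) simp
  have "((\<lambda>j. infsum (\<lambda>n. h n j) A) has_sum S) UNIV"
  proof (rule has_sum_SigmaD[OF swapped])
    fix j :: nat
    have "(\<lambda>n. h n j) summable_on A"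
      using summable_on_SigmaD1[of "\<lambda>j n. h n j" UNIV "\<lambda>_. A" j] swapped
      by (auto simp: summable_on_def)
    then show "((\<lambda>n. case (j, n) of (j, n) \<Rightarrow> h n j) has_sum infsum (\<lambda>n. h n j) A) A"
      by simp
  qed
  moreover have "infsum (\<lambda>n. h n j) A = infsum (\<lambda>n. c n * w n ^ j) A / fact j * t ^ j" for j
  proof -
    have "infsum (\<lambda>n. h n j) A = infsum (\<lambda>n. c n * w n ^ j * (t ^ j / fact j)) A"
      by (simp add: h_def power_mult_distrib mult_ac)
    also have "\<dots> = infsum (\<lambda>n. c n * w n ^ j) A * (t ^ j / fact j)"
      by (rule infsum_cmult_left')
    finally show ?thesis by simp
  qed
  ultimately show ?thesis by simp
qed

lemma abs_summable_prod_PiE: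
  fixes g :: "'a \<Rightarrow> nat \<Rightarrow> 'c :: {real_normed_field,banach,second_countable_topology}"
  assumes "finite I" and "\<And>i. i \<in> I \<Longrightarrow> summable (\<lambda>n. norm (g i n))"
  shows "(\<lambda>n. norm (\<Prod>i\<in>I. g i (n i))) summable_on (I \<rightarrow>\<^sub>E UNIV)"
proof -
  have "Infinite_Set_Sum.abs_summable_on (\<lambda>n. \<Prod>i\<in>I. g i (n i)) (I \<rightarrow>\<^sub>E UNIV)"
    using assms by (intro abs_summable_on_prod_PiE) (auto simp: abs_summable_on_nat_iff')
  then show ?thesis by (simp add: abs_summable_equivalent)
qed

text \<open>The type is general because this serves both the complex ratios \<open>x i\<close> and
  their real majorants \<open>y i\<close> below.\<close>

lemma power_mult_exp_power:
  fixes q t :: "'a :: {real_normed_field,banach}"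
  shows "(q ^ b * exp (of_nat a * t)) ^ m = q ^ (b * m) * exp (of_nat (a * m) * t)"
proof -
  have "exp (of_nat (a * m) * t) = exp (of_nat a * t) ^ m"
    by (simp add: mult_ac flip: exp_of_nat_mult)
  then show ?thesis by (simp add: power_mult_distrib power_mult)
qed

section \<open>The generating function and its Taylor coefficients\<close>

text \<open>The denominator is the same for all tuples \<open>m\<close>, and the numerator factors
  over the coordinates, so distributivity turns the sum over tuples into a product of sums.\<close>

lemma multi_euler_gf_eq_prod:
  "multi_euler_gf r q f chi a b t =
     2 ^ r * (\<Prod>i=1..r. (\<Sum>m<f. chi (int m) * (- (q ^ b i * exp (of_nat (a i) * t))) ^ m)
                          / ((q ^ b i * exp (of_nat (a i) * t)) ^ f + 1))"
proof -
  have "(\<Prod>i=1..r. \<Sum>m<f. chi (int m) * (- (q ^ b i * exp (of_nat (a i) * t))) ^ m) =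
    (\<Sum>m\<in>{1..r} \<rightarrow>\<^sub>E {0..<f}.
       \<Prod>i=1..r. chi (int (m i)) * (- (q ^ b i * exp (of_nat (a i) * t))) ^ m i)"
    by (subst prod_sum_PiE) (auto simp: atLeast0LessThan)
  also have "\<dots> = (\<Sum>m\<in>{1..r} \<rightarrow>\<^sub>E {0..<f}. (-1) ^ (\<Sum>i=1..r. m i) * q ^ (\<Sum>i=1..r. b i * m i)
         * exp (of_nat (\<Sum>i=1..r. a i * m i) * t) * (\<Prod>i=1..r. chi (int (m i))))"
  proof (rule sum.cong)
    fix m
    show "(\<Prod>i=1..r. chi (int (m i)) * (- (q ^ b i * exp (of_nat (a i) * t))) ^ m i) =
      (-1) ^ (\<Sum>i=1..r. m i) * q ^ (\<Sum>i=1..r. b i * m i)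
         * exp (of_nat (\<Sum>i=1..r. a i * m i) * t) * (\<Prod>i=1..r. chi (int (m i)))"
      by (simp add: power_minus[of "_ * _"] power_mult_exp_power prod.distrib power_sum exp_sum sum_distrib_right
            del: of_nat_mult)
  qed simp
  finally have "2 ^ r * (\<Prod>i=1..r. \<Sum>m<f. chi (int m) * (- (q ^ b i * exp (of_nat (a i) * t))) ^ m)
      / (\<Prod>i=1..r. (q ^ b i * exp (of_nat (a i) * t)) ^ f + 1) = multi_euler_gf r q f chi a b t"
    unfolding multi_euler_gf_def power_mult_exp_power
    by (simp only: sum_divide_distrib sum_distrib_left mult.assoc mult.commute[of f])
  then show ?thesis by (simp add: prod_dividef)
qed

lemma multi_euler_gf_has_sum:
  assumes "odd f" and per: "\<And>m. chi (m + int f) = chi m"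
    and small: "\<And>i. i \<in> {1..r} \<Longrightarrow> norm q ^ b i * exp (real (a i) * norm t) < 1"
  shows "((\<lambda>j. 2 ^ r * (\<Sum>\<^sub>\<infinity>n\<in>{1..r} \<rightarrow>\<^sub>E UNIV. (-1) ^ (\<Sum>i=1..r. n i) * q ^ (\<Sum>i=1..r. b i * n i)
             * (\<Prod>i=1..r. chi (int (n i))) * of_nat (\<Sum>i=1..r. a i * n i) ^ j) / fact j * t ^ j)
           has_sum multi_euler_gf r q f chi a b t) UNIV"
proof -
  define I where "I = {1..r}"
  define c :: "(nat \<Rightarrow> nat) \<Rightarrow> complex" where
    "c n = (-1) ^ (\<Sum>i\<in>I. n i) * q ^ (\<Sum>i\<in>I. b i * n i) * (\<Prod>i\<in>I. chi (int (n i)))" for n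
  define N where "N n = (\<Sum>i\<in>I. a i * n i)" for n
  define x where "x i = q ^ b i * exp (of_nat (a i) * t)" for i
  \<comment> \<open>The majorant uses \<open>norm t\<close> and not the real part of
    \<open>t\<close>, since \<open>has_sum_exp_series\<close> requires summability with
    \<open>exp (norm (w n * t))\<close>.\<close>
  define y where "y i = norm q ^ b i * exp (real (a i) * norm t)" for i
  define u where "u i n = chi (int n) * (- x i) ^ n" for i n
  have "finite I" by (simp add: I_def)
  have y01: "0 \<le> y i" "y i < 1" if "i \<in> I" for i
    using small[of i] that by (auto simp: y_def I_def)
  have xy: "norm (x i) \<le> y i" for i
  proof -
    have "Re (of_nat (a i) * t) \<le> real (a i) * norm t"
      by (simp add: mult_left_mono complex_Re_le_cmod)
    then show ?thesis
      unfolding x_def y_def by (simp add: norm_mult norm_power mult_left_mono)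
  qed
  have "f > 0" using \<open>odd f\<close> by (auto intro: Nat.gr0I)
  then obtain M where M: "\<And>m. norm (chi m) \<le> M"
    using periodic_imp_bounded per by metis
  have c_exp: "c n * exp (of_nat (N n) * t) = (\<Prod>i\<in>I. u i (n i))" for n
  proof -
    have "x i ^ m = q ^ (b i * m) * exp (of_nat (a i * m) * t)" for i m
      unfolding x_def by (rule power_mult_exp_power)
    then show ?thesis
      using \<open>finite I\<close>
      by (simp add: c_def N_def u_def power_minus[of "x _"] prod.distrib power_sum exp_sum
            sum_distrib_right del: of_nat_mult)
  qed
  \<comment> \<open>The outer \<open>norm\<close> gives the shape of
    \<open>abs_summable_prod_PiE\<close>, applied to a real family dominated by geometric series of
    ratio \<open>y i\<close>.\<close>
  have norm_c_exp: "norm (c n) * exp (norm (of_nat (N n) * t))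
      = norm (\<Prod>i\<in>I. norm (chi (int (n i))) * y i ^ n i)" for n
  proof -
    have "y i ^ m = norm q ^ (b i * m) * exp (real (a i * m) * norm t)" for i m
      unfolding y_def by (rule power_mult_exp_power)
    moreover have "norm (of_nat (N n) * t) = (\<Sum>i\<in>I. real (a i * n i) * norm t)"
      by (simp add: N_def norm_mult norm_of_nat sum_distrib_right del: of_nat_mult of_nat_sum)
         (simp add: sum_distrib_right)
    ultimately show ?thesis
      using \<open>finite I\<close>
      by (simp add: c_def norm_mult norm_power prod.distrib power_sum exp_sum abs_mult
            abs_prod del: of_nat_mult flip: prod_norm)
  qed
  have "(\<lambda>n. norm (c n) * exp (norm (of_nat (N n) * t))) summable_on (I \<rightarrow>\<^sub>E UNIV)"
    unfolding norm_c_exp using \<open>finite I\<close>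
  proof (rule abs_summable_prod_PiE)
    fix i assume "i \<in> I"
    then show "summable (\<lambda>n. norm (norm (chi (int n)) * y i ^ n))"
      using summable_power_mult_bounded[of "y i" "\<lambda>n. chi (int n)" M] y01 M
      by (simp add: abs_mult)
  qed
  moreover have "((\<lambda>n. c n * exp (of_nat (N n) * t)) has_sum (\<Prod>i\<in>I. infsum (u i) UNIV)) (I \<rightarrow>\<^sub>E UNIV)"
  proof -
    have su: "summable (\<lambda>n. norm (u i n))" if "i \<in> I" for i
      using summable_power_mult_bounded[of "norm (x i)" "\<lambda>n. chi (int n)" M] y01[OF that] xy[of i] M
      by (simp add: u_def norm_mult norm_power)
    have "(\<lambda>n. \<Prod>i\<in>I. u i (n i)) summable_on (I \<rightarrow>\<^sub>E UNIV)"
      by (rule abs_summable_summable[OF abs_summable_prod_PiE[OF \<open>finite I\<close> su]])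
    moreover have "infsum (\<lambda>n. \<Prod>i\<in>I. u i (n i)) (I \<rightarrow>\<^sub>E UNIV) = (\<Prod>i\<in>I. infsum (u i) UNIV)"
      using \<open>finite I\<close> su
      by (intro infsum_prod_PiE_abs) (auto intro!: norm_summable_imp_summable_on)
    ultimately show ?thesis
      unfolding c_exp by (metis has_sum_infsum)
  qed
  ultimately have "((\<lambda>j. infsum (\<lambda>n. c n * of_nat (N n) ^ j) (I \<rightarrow>\<^sub>E UNIV) / fact j * t ^ j)
      has_sum (\<Prod>i\<in>I. infsum (u i) UNIV)) UNIV"
    by (rule has_sum_exp_series)
  then have "((\<lambda>j. 2 ^ r * (infsum (\<lambda>n. c n * of_nat (N n) ^ j) (I \<rightarrow>\<^sub>E UNIV) / fact j * t ^ j))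
      has_sum 2 ^ r * (\<Prod>i\<in>I. infsum (u i) UNIV)) UNIV"
    by (rule has_sum_cmult_right)
  also have "(\<Prod>i\<in>I. infsum (u i) UNIV) = (\<Prod>i\<in>I. (\<Sum>m<f. u i m) / (x i ^ f + 1))"
  proof (rule prod.cong)
    fix i assume "i \<in> I"
    then have "norm (x i) < 1" using y01[of i] xy[of i] by linarith
    from has_sum_alternating_periodic[where chi = chi, OF \<open>odd f\<close> per this]
    show "infsum (u i) UNIV = (\<Sum>m<f. u i m) / (x i ^ f + 1)"
      unfolding u_def by (rule infsumI)
  qed simp
  also have "2 ^ r * \<dots> = multi_euler_gf r q f chi a b t"
    by (simp add: multi_euler_gf_eq_prod u_def x_def I_def)
  finally show ?thesis
    by (simp add: c_def N_def I_def mult_ac)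
qed

text \<open>The multiple exponential sum gives a power series for the generating function near
  \<open>0\<close>; uniqueness of Taylor coefficients identifies \<open>F k\<close> with the Euler
  number.\<close>

lemma multi_euler_eq_infsum:
  assumes "norm q < 1" "\<forall>i\<in>{1..r}. b i > 0" "odd f" "\<And>m. chi (m + int f) = chi m"
  shows "multi_euler r q f chi a b k =
    2 ^ r * (\<Sum>\<^sub>\<infinity>n\<in>{1..r} \<rightarrow>\<^sub>E UNIV. (-1) ^ (\<Sum>i=1..r. n i) * q ^ (\<Sum>i=1..r. b i * n i)
      * (\<Prod>i=1..r. chi (int (n i))) * of_nat (\<Sum>i=1..r. a i * n i) ^ k)"
proof -
  define F where "F j = 2 ^ r * (\<Sum>\<^sub>\<infinity>n\<in>{1..r} \<rightarrow>\<^sub>E UNIV.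
      (-1) ^ (\<Sum>i=1..r. n i) * q ^ (\<Sum>i=1..r. b i * n i)
      * (\<Prod>i=1..r. chi (int (n i))) * of_nat (\<Sum>i=1..r. a i * n i) ^ j)" for j
  \<comment> \<open>At \<open>t = 0\<close> the condition reads \<open>norm q ^ b i < 1\<close>;
    continuity and finiteness of \<open>{1..r}\<close> extend it to a neighbourhood.\<close>
  have "\<forall>\<^sub>F t in nhds 0. \<forall>i\<in>{1..r}. norm q ^ b i * exp (real (a i) * norm (t :: complex)) < 1"
  proof (intro eventually_ball_finite ballI)
    fix i assume "i \<in> {1..r}"
    then have "norm q ^ b i < 1"
      using assms by (auto simp: power_less_one_iff)
    moreover have "((\<lambda>t :: complex. norm q ^ b i * exp (real (a i) * norm t)) \<longlongrightarrow>
        norm q ^ b i * exp (real (a i) * norm (0 :: complex))) (nhds 0)"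
      by (intro tendsto_intros filterlim_ident)
    ultimately show "\<forall>\<^sub>F t in nhds 0. norm q ^ b i * exp (real (a i) * norm (t :: complex)) < 1"
      by (intro order_tendstoD(2)) auto
  qed simp
  then have "\<forall>\<^sub>F t in nhds 0. (\<lambda>j. F j / fact j * t ^ j) sums multi_euler_gf r q f chi a b t"
  proof eventually_elim
    case (elim t)
    then show ?case
      unfolding F_def using assms by (intro has_sum_imp_sums multi_euler_gf_has_sum) auto
  qed
  then have "multi_euler_gf r q f chi a b has_fps_expansion Abs_fps (\<lambda>j. F j / fact j)"
    by (intro has_fps_expansionI) simp
  from fps_expansion_eqI[OF this] have "multi_euler r q f chi a b k = F k"
    by (simp add: multi_euler_def)
  then show ?thesis by (simp add: F_def)
qed

text \<open>The two series differ only in tuples with a zero index. The hypothesis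
  \<open>f > 1 \<or> r = 1\<close> makes these terms vanish. For \<open>f = 1\<close>,
  \<open>r = 2\<close>, \<open>k = 1\<close> and all \<open>a i = b i = 1\<close> they add up to
  \<open>- 8 * q / (1 + q)^2\<close>, which is nonzero for \<open>q \<noteq> 0\<close>.\<close>

theorem theorem4:
  fixes q :: complex and r f k :: nat and a b :: "nat \<Rightarrow> nat" and chi :: "int \<Rightarrow> complex"
  assumes "norm q < 1"
    and "r \<ge> 1"
    and "\<forall>i\<in>{1..r}. a i > 0"
    and "\<forall>i\<in>{1..r}. b i > 0"
    and "dirichlet_character f chi"
    and "conductor f chi = f"
    and "odd f"
    and "k > 0"
    and "f > 1 \<or> r = 1"
  shows "multi_L r q (- of_nat k) chi a b = multi_euler r q f chi a b k"
proof -
  have per: "chi (m + int f) = chi m" for m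
    using assms by (simp add: dirichlet_character_def)
  have "multi_L r q (- of_nat k) chi a b =
    2 ^ r * (\<Sum>\<^sub>\<infinity>n\<in>{1..r} \<rightarrow>\<^sub>E UNIV. (-1) ^ (\<Sum>i=1..r. n i) * q ^ (\<Sum>i=1..r. b i * n i)
      * (\<Prod>i=1..r. chi (int (n i))) * of_nat (\<Sum>i=1..r. a i * n i) ^ k)"
    unfolding multi_L_def
  \<comment> \<open>The index sets are nested: the first difference is empty, the second holds the
    tuples with a zero index, and on the intersection the terms agree.\<close>
  proof (intro arg_cong2[where f = "(*)"] refl infsum_cong_neutral)
    fix n assume "n \<in> ({1..r} \<rightarrow>\<^sub>E {1..}) - ({1..r} \<rightarrow>\<^sub>E (UNIV :: nat set))"
    then show "(-1) ^ (\<Sum>i=1..r. n i) * q ^ (\<Sum>i=1..r. b i * n i) * (\<Prod>i=1..r. chi (int (n i)))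
      / of_nat (\<Sum>i=1..r. a i * n i) powr (- of_nat k) = 0"
      by (auto simp: PiE_def)
  next
    fix n assume "n \<in> ({1..r} \<rightarrow>\<^sub>E UNIV) - ({1..r} \<rightarrow>\<^sub>E {1::nat..})"
    then obtain i where i: "i \<in> {1..r}" "n i = 0"
      by (force simp: PiE_def Pi_def)
    \<comment> \<open>A vanishing index kills the term through \<open>chi 0 = 0\<close> unless \<open>f = 1\<close>;
      in that case \<open>r = 1\<close>, and the factor \<open>0 ^ k\<close> does it.\<close>
    show "(-1) ^ (\<Sum>i=1..r. n i) * q ^ (\<Sum>i=1..r. b i * n i) * (\<Prod>i=1..r. chi (int (n i)))
      * of_nat (\<Sum>i=1..r. a i * n i) ^ k = 0"
    proof (cases "f > 1")
      case True
      then have "chi 0 = 0"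
        using assms by (simp add: dirichlet_character_def)
      with i have "(\<Prod>i=1..r. chi (int (n i))) = 0"
        by (intro prod_zero) (auto intro!: bexI[of _ i])
      then show ?thesis by simp
    next
      case False
      with assms i show ?thesis by auto
    qed
  next
    fix n assume "n \<in> ({1..r} \<rightarrow>\<^sub>E {1..}) \<inter> ({1..r} \<rightarrow>\<^sub>E (UNIV :: nat set))"
    then have n: "n 1 \<ge> 1" using \<open>r \<ge> 1\<close> by (auto simp: PiE_def Pi_def)
    \<comment> \<open>One positive summand makes the base nonzero, so the complex
      \<open>powr\<close> with exponent \<open>- of_nat k\<close> is an ordinary inverse
      power.\<close>
    have "a 1 * n 1 \<le> (\<Sum>i=1..r. a i * n i)"
      using \<open>r \<ge> 1\<close> by (intro member_le_sum) auto
    moreover have "a 1 * n 1 > 0" using assms n by auto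
    ultimately have "(of_nat (\<Sum>i=1..r. a i * n i) :: complex) \<noteq> 0"
      by (metis of_nat_eq_0_iff not_le)
    then have "(of_nat (\<Sum>i=1..r. a i * n i) :: complex) powr (- of_nat k)
        = inverse (of_nat (\<Sum>i=1..r. a i * n i) ^ k)"
      by (simp add: powr_minus powr_nat' del: of_nat_sum)
    then show "(-1) ^ (\<Sum>i=1..r. n i) * q ^ (\<Sum>i=1..r. b i * n i) * (\<Prod>i=1..r. chi (int (n i)))
      / of_nat (\<Sum>i=1..r. a i * n i) powr (- of_nat k) =
      (-1) ^ (\<Sum>i=1..r. n i) * q ^ (\<Sum>i=1..r. b i * n i) * (\<Prod>i=1..r. chi (int (n i)))
      * of_nat (\<Sum>i=1..r. a i * n i) ^ k"
      by (simp add: divide_inverse del: of_nat_sum)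
  qed
  also have "\<dots> = multi_euler r q f chi a b k"
    using assms per by (intro multi_euler_eq_infsum [symmetric]) auto
  finally show ?thesis .
qed

end
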